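(* Every tree is absolute-clear.
   Context: All graphs are finite, simple, undirected and connected. A tree is a connected graph with no cycles. For a graph $G$ and $Q\subseteq V(G)$, two vertices $u,v$ are $Q$-visible if there is a shortest $(u,v)$-path in $G$ all of whose internal vertices lie outside $Q$. A set $Y\subseteq V(G)$ is $Q$-visible if every pair of vertices of $Y$ is $Q$-visible; $Q$ is a mutual-visibility set of $G$ if $Q$ is $Q$-visible. A subset $W\subseteq V(G)\setminus Q$ is a $c_Q$-visible set if $W$ is $Q$-visible and, in addition, every pair $\{u,w\}$ with $u\in Q$ and $w\in W$ is $Q$-visible. A $c_Q$-visible set is maximal if it is not properly contained in any larger $c_Q$-visible set. A $c_Q$-visible set $W$ is an absolute $c_Q$-visible set if $Q$ itself is a mutual-visibility set of $G$ (equivalently, $Q\cup W$ is $Q$-visible). A subset $Q\subseteq V(G)$ is disjoint-visible if, whenever there exist multiple maximal absolute $c_Q$-visible sets, they are pairwise disjoint. A graph $G$ is absolute-clear if every nonempty subset of $V(G)$ is disjoint-visible. *)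

theory Defs
  imports "Graph_Theory.Kuratowski"
begin

text \<open>
  Finite simple undirected graphs are represented by the locale \<^term>\<open>graph\<close>: finite, loop-free,
  symmetric digraphs without parallel arcs, so that an undirected edge is a pair of opposite arcs.
  Under this representation \<^const>\<open>tree\<close> does not describe undirected trees, because traversing
  an edge back and forth is a \<^const>\<open>pre_digraph.cycle\<close> of length 2. The cycles of the undirected
  graph are exactly those of length at least 3. Connectedness includes having at least one vertex.
\<close>

definition undirected_tree :: "('a, 'b) pre_digraph \<Rightarrow> bool" where
  "undirected_tree G \<longleftrightarrow> graph G \<and> Digraph_Component.connected G \<and>
     \<not> (\<exists>p. pre_digraph.cycle G p \<and> length p \<ge> 3)"

definition shortest_apath :: "('a, 'b) pre_digraph \<Rightarrow> 'a \<Rightarrow> 'b awalk \<Rightarrow> 'a \<Rightarrow> bool" where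
  "shortest_apath G u p v \<longleftrightarrow> pre_digraph.apath G u p v \<and>
     (\<forall>q. pre_digraph.apath G u q v \<longrightarrow> length p \<le> length q)"

definition visible :: "('a, 'b) pre_digraph \<Rightarrow> 'a set \<Rightarrow> 'a \<Rightarrow> 'a \<Rightarrow> bool" where
  "visible G Q u v \<longleftrightarrow>
     (\<exists>p. shortest_apath G u p v \<and> set (pre_digraph.inner_verts G p) \<inter> Q = {})"

text \<open>
  Pairs with equal components may be included below: every vertex is visible from itself by the
  empty path.
\<close>

definition visible_set :: "('a, 'b) pre_digraph \<Rightarrow> 'a set \<Rightarrow> 'a set \<Rightarrow> bool" where
  "visible_set G Q Y \<longleftrightarrow> Y \<subseteq> verts G \<and> (\<forall>u\<in>Y. \<forall>v\<in>Y. visible G Q u v)"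

definition mutual_visibility_set :: "('a, 'b) pre_digraph \<Rightarrow> 'a set \<Rightarrow> bool" where
  "mutual_visibility_set G Q \<longleftrightarrow> visible_set G Q Q"

definition c_visible_set :: "('a, 'b) pre_digraph \<Rightarrow> 'a set \<Rightarrow> 'a set \<Rightarrow> bool" where
  "c_visible_set G Q W \<longleftrightarrow> W \<subseteq> verts G - Q \<and> visible_set G Q W \<and>
     (\<forall>u\<in>Q. \<forall>w\<in>W. visible G Q u w)"

definition maximal_c_visible_set :: "('a, 'b) pre_digraph \<Rightarrow> 'a set \<Rightarrow> 'a set \<Rightarrow> bool" where
  "maximal_c_visible_set G Q W \<longleftrightarrow> c_visible_set G Q W \<and>
     \<not> (\<exists>W'. c_visible_set G Q W' \<and> W \<subset> W')"

definition absolute_c_visible_set :: "('a, 'b) pre_digraph \<Rightarrow> 'a set \<Rightarrow> 'a set \<Rightarrow> bool" where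
  "absolute_c_visible_set G Q W \<longleftrightarrow> c_visible_set G Q W \<and> mutual_visibility_set G Q"

text \<open>
  Absoluteness of a c-visible set depends on \<open>Q\<close> only, so maximality among the absolute c-visible
  sets is the same as maximality among all c-visible sets.
\<close>

definition disjoint_visible :: "('a, 'b) pre_digraph \<Rightarrow> 'a set \<Rightarrow> bool" where
  "disjoint_visible G Q \<longleftrightarrow>
     pairwise disjnt {W. maximal_c_visible_set G Q W \<and> absolute_c_visible_set G Q W}"

definition absolute_clear :: "('a, 'b) pre_digraph \<Rightarrow> bool" where
  "absolute_clear G \<longleftrightarrow> (\<forall>Q. Q \<subseteq> verts G \<and> Q \<noteq> {} \<longrightarrow> disjoint_visible G Q)"

end

theory Submission
  imports Defs
begin

text \<open>
  In a tree, paths between two given vertices are unique. Hence, if \<open>x \<notin> Q\<close> is visible from both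
  \<open>a\<close> and \<open>b\<close>, then \<open>a\<close> and \<open>b\<close> are visible to each other: their path is contained in the union
  of the paths through \<open>x\<close>. If two maximal c-visible sets share a vertex \<open>x\<close>, which lies outside
  \<open>Q\<close>, their union is therefore c-visible, and maximality forces them to coincide.
\<close>

text \<open>Cutting the closed detours out of a walk introduces no vertices, so whatever the walk
  avoids, the resulting path avoids too.\<close>

lemma (in wf_digraph) awalk_imp_apath_verts_subset:
  assumes "awalk u p v"
  obtains q where "apath u q v" "set (awalk_verts u q) \<subseteq> set (awalk_verts u p)"
proof
  show path: "apath u (awalk_to_apath p) v"
    using assms by (rule apath_awalk_to_apath)
  show "set (awalk_verts u (awalk_to_apath p)) \<subseteq> set (awalk_verts u p)"
    using awalk_to_apath_subset[OF assms] set_awalk_verts[OF assms]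
      set_awalk_verts[OF awalkI_apath[OF path]] by auto
qed

text \<open>By symmetry each arc has an opposite one; induction appends the opposite of the first
  arc at the end.\<close>

lemma (in sym_digraph) awalk_reverse:
  assumes "awalk u p v"
  obtains q where "awalk v q u" "set (awalk_verts v q) = set (awalk_verts u p)"
proof -
  have "\<exists>q. awalk v q u \<and> set (awalk_verts v q) = set (awalk_verts u p)"
    using assms
  proof (induction p arbitrary: u)
    case Nil
    then show ?case
      by (intro exI[of _ "[]"]) (auto simp: awalk_Nil_iff)
  next
    case (Cons e p)
    then have e: "e \<in> arcs G" "tail G e = u" and "awalk (head G e) p v"
      by (auto simp: awalk_Cons_iff)
    with Cons.IH obtain q where q: "awalk v q (head G e)"
        "set (awalk_verts v q) = set (awalk_verts (head G e) p)"
      by blast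
    obtain f where f: "f \<in> arcs G" "tail G f = head G e" "head G f = u"
      using sym_arcs e by (fastforce simp: symmetric_conv)
    have walk: "awalk (head G e) [f] u"
      using f arc_implies_awalk by metis
    \<comment> \<open>Appending \<open>f\<close> contributes both its ends, but its tail is already
      on \<open>q\<close>, so only \<open>u\<close> can be new.\<close>
    have "head G e \<in> set (awalk_verts v q)"
      using q(2) hd_in_awalk_verts(1)[OF \<open>awalk (head G e) p v\<close>] by simp
    then have "set (awalk_verts v (q @ [f])) = set (awalk_verts u (e # p))"
      using set_awalk_verts_append[OF q(1) walk] q(2) e f by auto
    with awalk_appendI[OF q(1) walk] show ?case by blast
  qed
  with that show thesis by blast
qed

context graph
begin

text \<open>Leave \<open>u\<close> along \<open>e\<close>, follow a path to \<open>head G f\<close>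
  that avoids \<open>u\<close>, and return along the opposite of \<open>f\<close>.\<close>

lemma cycle_if_awalk_avoids:
  assumes "e \<in> arcs G" "f \<in> arcs G" "tail G e = u" "tail G f = u" "e \<noteq> f"
    and "awalk (head G e) p (head G f)" "u \<notin> set (awalk_verts (head G e) p)"
  shows "\<exists>c. cycle c \<and> length c \<ge> 3"
proof -
  obtain r where r: "apath (head G e) r (head G f)"
      "set (awalk_verts (head G e) r) \<subseteq> set (awalk_verts (head G e) p)"
    using awalk_imp_apath_verts_subset[OF assms(6)] by blast
  obtain g where g: "g \<in> arcs G" "tail G g = head G f" "head G g = u"
    using sym_arcs assms(2,4) by (fastforce simp: symmetric_conv)
  \<comment> \<open>Parallel arcs are excluded, so the middle path has at least one arc; this rules
    out the degenerate cycle of length 2 that goes back and forth along one edge.\<close>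
  have "head G e \<noteq> head G f"
    using no_multi_arcs[of e f] assms by (auto simp: arc_to_ends_def)
  then have "r \<noteq> []"
    using r(1) by (auto simp: apath_Nil_iff)
  have return: "awalk (head G f) [g] u"
    using g arc_implies_awalk by metis
  have walk: "awalk (head G e) (r @ [g]) u"
    using awalk_appendI[OF awalkI_apath[OF r(1)] return] .
  have "awalk_verts (head G e) (r @ [g]) = awalk_verts (head G e) r @ [u]"
    using awalk_verts_append[OF walk] g r(1) by (auto simp: apath_def)
  \<comment> \<open>These are the vertices of the closed walk without its initial \<open>u\<close>,
    which is the list that \<open>cycle\<close> requires to be distinct.\<close>
  then have "distinct (awalk_verts (head G e) (r @ [g]))"
    using r assms(7) by (auto simp: apath_def)
  moreover have "awalk u (e # r @ [g]) u"
    using walk assms by (simp add: awalk_Cons_iff del: awalk_append_iff)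
  ultimately have "cycle (e # r @ [g])"
    unfolding cycle_def by (intro exI[of _ u]) simp
  moreover have "length (e # r @ [g]) \<ge> 3"
    using \<open>r \<noteq> []\<close> by (cases r) auto
  ultimately show ?thesis by blast
qed

text \<open>If two paths leave \<open>u\<close> by different arcs, the rest of one followed by the
  reversed rest of the other joins the heads of these arcs. Neither rest returns to
  \<open>u\<close>, so a cycle arises.\<close>

lemma apath_unique_if_acyclic:
  assumes acyclic: "\<not> (\<exists>c. cycle c \<and> length c \<ge> 3)"
    and "apath u p v" "apath u q v"
  shows "p = q"
  using assms(2,3)
proof (induction p arbitrary: u q)
  case Nil
  then show ?case
    using apath_nonempty_ends by (auto simp: apath_Nil_iff)
next
  case (Cons e p)
  then have "q \<noteq> []"
    using apath_nonempty_ends by (auto simp: apath_Nil_iff)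
  then obtain f q' where q: "q = f # q'" by (cases q) auto
  have e: "e \<in> arcs G" "tail G e = u" "apath (head G e) p v"
      "u \<notin> set (awalk_verts (head G e) p)"
    using Cons.prems(1) by (auto simp: apath_Cons_iff)
  have f: "f \<in> arcs G" "tail G f = u" "apath (head G f) q' v"
      "u \<notin> set (awalk_verts (head G f) q')"
    using Cons.prems(2) unfolding q by (auto simp: apath_Cons_iff)
  have "e = f"
  proof (rule ccontr)
    assume "e \<noteq> f"
    obtain s where s: "awalk v s (head G f)"
        "set (awalk_verts v s) = set (awalk_verts (head G f) q')"
      using awalk_reverse[OF awalkI_apath[OF f(3)]] .
    have "awalk (head G e) (p @ s) (head G f)"
      using awalk_appendI[OF awalkI_apath[OF e(3)] s(1)] .
    moreover have "u \<notin> set (awalk_verts (head G e) (p @ s))"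
      using set_awalk_verts_append[OF awalkI_apath[OF e(3)] s(1)] s(2) e(4) f(4) by simp
    ultimately show False
      using cycle_if_awalk_avoids[OF e(1) f(1) e(2) f(2) \<open>e \<noteq> f\<close>] acyclic by blast
  qed
  with Cons.IH e(3) f(3) q show ?case by blast
qed

lemma visible_trans_if_acyclic:
  assumes acyclic: "\<not> (\<exists>c. cycle c \<and> length c \<ge> 3)"
    and "visible G Q u x" "visible G Q x v" "x \<notin> Q"
  shows "visible G Q u v"
proof -
  obtain p q where p: "apath u p x" "set (inner_verts p) \<inter> Q = {}"
    and q: "apath x q v" "set (inner_verts q) \<inter> Q = {}"
    using assms(2,3) by (auto simp: visible_def shortest_apath_def)
  have walks: "awalk u p x" "awalk x q v"
    using p(1) q(1) by (auto intro: awalkI_apath)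
  obtain r where r: "apath u r v" "set (awalk_verts u r) \<subseteq> set (awalk_verts u (p @ q))"
    using awalk_imp_apath_verts_subset[OF awalk_appendI[OF walks]] .
  \<comment> \<open>A vertex of \<open>r\<close> other than \<open>u\<close> and \<open>v\<close> is
    internal to \<open>p\<close> or \<open>q\<close>, or equals \<open>x\<close>.\<close>
  have "set (inner_verts r) \<inter> Q = {}"
    using r(2) p(2) q(2) \<open>x \<notin> Q\<close>
    unfolding set_inner_verts[OF r(1)] set_inner_verts[OF p(1)] set_inner_verts[OF q(1)]
      set_awalk_verts_append[OF walks] by blast
  \<comment> \<open>As the only path from \<open>u\<close> to \<open>v\<close>, \<open>r\<close> is
    trivially shortest.\<close>
  moreover have "shortest_apath G u r v"
    unfolding shortest_apath_def using r(1) apath_unique_if_acyclic[OF acyclic r(1)] by blast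
  ultimately show ?thesis
    unfolding visible_def by blast
qed

lemma c_visible_set_Un_if_acyclic:
  assumes acyclic: "\<not> (\<exists>c. cycle c \<and> length c \<ge> 3)"
    and "c_visible_set G Q W" "c_visible_set G Q W'" "x \<in> W" "x \<in> W'"
  shows "c_visible_set G Q (W \<union> W')"
proof -
  \<comment> \<open>Only pairs with one vertex in each of \<open>W\<close> and \<open>W'\<close> are
    new in the union; these are linked through the common vertex \<open>x\<close>.\<close>
  have "x \<notin> Q" and via_x: "visible G Q a x \<and> visible G Q x a" if "a \<in> W \<union> W'" for a
    using assms(2-) that by (auto simp: c_visible_set_def visible_set_def)
  then have "visible G Q a b" if "a \<in> W \<union> W'" "b \<in> W \<union> W'" for a b
    using visible_trans_if_acyclic[OF acyclic] that by blast
  then show ?thesis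
    using assms(2,3) unfolding c_visible_set_def visible_set_def by blast
qed

end

theorem theorem10:
  fixes G :: "('a, 'b) pre_digraph"
  assumes "undirected_tree G"
  shows "absolute_clear G"
proof -
  interpret graph G using assms by (simp add: undirected_tree_def)
  have acyclic: "\<not> (\<exists>c. cycle c \<and> length c \<ge> 3)"
    using assms by (simp add: undirected_tree_def)
  have "W = W'"
    if W: "maximal_c_visible_set G Q W" and W': "maximal_c_visible_set G Q W'"
      and x: "x \<in> W" "x \<in> W'" for Q W W' x
  proof -
    have "c_visible_set G Q (W \<union> W')"
      using c_visible_set_Un_if_acyclic[OF acyclic _ _ x] W W'
      by (simp add: maximal_c_visible_set_def)
    with W W' show ?thesis
      unfolding maximal_c_visible_set_def by blast
  qed
  then show ?thesis
    unfolding absolute_clear_def disjoint_visible_def pairwise_def disjnt_iff by blast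
qed

end
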